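(* Let $f=(f_1,f_2)$ with $0<f_1,f_2<1$, $J$ a finite index set, $r_j=(r^1_j,r^2_j)\in\mathbb{R}^2$ ($j\in J$), $J_1\subseteq J$. Let $\bar v_1,\dots,\bar v_4,\bar w_1,\dots,\bar w_4\ge0$ satisfy $f_1\bar v_1+f_2\bar w_1=1$, $(1-f_1)\bar v_2+f_2\bar w_2=1$, $(1-f_1)\bar v_3+(1-f_2)\bar w_3=1$, $f_1\bar v_4+(1-f_2)\bar w_4=1$. For $j\in J_1$ let $$\bar\alpha_j=\min_{m^1_j,m^2_j\in\mathbb{Z}}\max\Big\{-(r^1_j-m^1_j)\bar v_1-(r^2_j-m^2_j)\bar w_1,\ (r^1_j-m^1_j)\bar v_2-(r^2_j-m^2_j)\bar w_2,\ (r^1_j-m^1_j)\bar v_3+(r^2_j-m^2_j)\bar w_3,\ -(r^1_j-m^1_j)\bar v_4+(r^2_j-m^2_j)\bar w_4\Big\}$$ (the coefficients of the strengthened cut $\bar\alpha s\ge1$). Then $0\le\bar\alpha_j\le1$ for all $j\in J_1$.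
   Context: This minimum equals the optimal value of the mixed integer program minimizing $\alpha_j$ subject to $\alpha_j$ being at least each of the four expressions, over integers $m^1_j,m^2_j$. *)

theory Defs
  imports "HOL-Analysis.Analysis"
begin

text \<open>The vectors \<open>v\<close> and \<open>w\<close> are used only at the indices 1, ..., 4.\<close>

definition four_max :: "(nat \<Rightarrow> real) \<Rightarrow> (nat \<Rightarrow> real) \<Rightarrow> real \<Rightarrow> real \<Rightarrow> real" where
  "four_max v w x y =
     Max {- x * v 1 - y * w 1, x * v 2 - y * w 2, x * v 3 + y * w 3, - x * v 4 + y * w 4}"

text \<open>The minimum is the least element of the set of attained values, not merely its infimum:
  if no integer pair attained the minimum, \<open>LEAST\<close> would be unspecified.\<close>

definition strengthened_coeff :: "(nat \<Rightarrow> real) \<Rightarrow> (nat \<Rightarrow> real) \<Rightarrow> real ^ 2 \<Rightarrow> real" where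
  "strengthened_coeff v w r =
     (LEAST a. \<exists>m1 m2 :: int. a = four_max v w (r $ 1 - of_int m1) (r $ 2 - of_int m2))"

end

theory Submission
  imports Defs
begin

text \<open>The piecewise linear gauge \<open>four_max v w\<close> is nonnegative, because in each quadrant one of its
  four pieces is, and it is at most 1 on the unit box
  \<open>[- f\<^sub>1, 1 - f\<^sub>1] \<times> [- f\<^sub>2, 1 - f\<^sub>2]\<close>, which meets every translate of the integer lattice.
  The delicate point is that the minimum over the lattice is attained, as the gauge need not be
  coercive. The normalisations leave only the four axis directions as possible zeros away from the
  origin. If the gauge is positive in all of them, its sublevel sets are bounded. If it vanishes in
  one of them, then on the closed half-plane around that direction it coincides with the maximum of
  two pieces depending only on the other coordinate. That maximum is a lower bound everywhere, and
  it attains its minimum over the shifted integers.\<close>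

section \<open>Nonnegativity of the gauge\<close>

lemma four_max_eq:
  "four_max v w x y =
    max (max (- x * v 1 - y * w 1) (x * v 2 - y * w 2)) (max (x * v 3 + y * w 3) (- x * v 4 + y * w 4))"
  by (simp add: four_max_def max.assoc)

lemma four_max_nonneg:
  assumes "\<forall>i\<in>{1..4}. 0 \<le> v i \<and> 0 \<le> w i"
  shows "0 \<le> four_max v w x y"
proof -
  have nn: "0 \<le> v 1" "0 \<le> v 2" "0 \<le> v 3" "0 \<le> v 4" "0 \<le> w 1" "0 \<le> w 2" "0 \<le> w 3" "0 \<le> w 4"
    using assms by auto
  consider "x \<le> 0" "y \<le> 0" | "0 \<le> x" "y \<le> 0" | "0 \<le> x" "0 \<le> y" | "x \<le> 0" "0 \<le> y"
    by linarith
  then show ?thesis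
  proof cases
    case 1
    then have "x * v 1 \<le> 0" "y * w 1 \<le> 0" using nn by (simp_all add: mult_nonpos_nonneg)
    then show ?thesis by (simp add: four_max_eq le_max_iff_disj)
  next
    case 2
    then have "0 \<le> x * v 2" "y * w 2 \<le> 0" using nn by (simp_all add: mult_nonpos_nonneg)
    then show ?thesis by (simp add: four_max_eq le_max_iff_disj)
  next
    case 3
    then have "0 \<le> x * v 3" "0 \<le> y * w 3" using nn by simp_all
    then show ?thesis by (simp add: four_max_eq le_max_iff_disj)
  next
    case 4
    then have "x * v 4 \<le> 0" "0 \<le> y * w 4" using nn by (simp_all add: mult_nonpos_nonneg)
    then show ?thesis by (simp add: four_max_eq le_max_iff_disj)
  qed
qed

section \<open>Attained minima over shifted integers\<close>

lemma ex_minimum_if_finite_sublevel: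
  fixes F :: "'a \<Rightarrow> real"
  assumes fin: "finite {z. F z \<le> F a}"
  shows "\<exists>z0. \<forall>z. F z0 \<le> F z"
proof -
  let ?A = "{z. F z \<le> F a}"
  have ne: "?A \<noteq> {}" by auto
  have "Min (F ` ?A) \<in> F ` ?A" using fin ne by (intro Min_in) auto
  then obtain z0 where z0: "z0 \<in> ?A" "F z0 = Min (F ` ?A)" by auto
  have "F z0 \<le> F z" for z
  proof (cases "z \<in> ?A")
    case True
    then show ?thesis using fin by (simp add: z0(2))
  next
    case False
    then show ?thesis using z0(1) by auto
  qed
  then show ?thesis by blast
qed

lemma finite_int_shift:
  fixes t K :: real
  shows "finite {m :: int. \<bar>t - of_int m\<bar> \<le> K}"
proof (rule finite_subset)
  show "{m :: int. \<bar>t - of_int m\<bar> \<le> K} \<subseteq> {\<lfloor>t - K\<rfloor>..\<lceil>t + K\<rceil>}"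
    by (auto simp: floor_le_iff le_ceiling_iff abs_le_iff)
qed simp

text \<open>Both slopes are positive, so a bound on the maximum bounds \<open>t - of_int m\<close>
  from both sides, and only finitely many integers compete with \<open>0\<close>.\<close>

lemma ex_minimum_two_max:
  fixes p q t :: real
  assumes "0 < p" "0 < q"
  shows "\<exists>m0 :: int. \<forall>m :: int. max (- (t - of_int m0) * p) ((t - of_int m0) * q)
    \<le> max (- (t - of_int m) * p) ((t - of_int m) * q)"
proof (rule ex_minimum_if_finite_sublevel)
  let ?C = "max (- (t - of_int 0) * p) ((t - of_int 0) * q)"
  have "\<bar>s\<bar> \<le> max (?C / p) (?C / q)" if "max (- s * p) (s * q) \<le> ?C" for s
  proof -
    have "- s \<le> ?C / p" "s \<le> ?C / q"
      using that assms by (simp_all add: pos_le_divide_eq del: max.bounded_iff)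
    then show ?thesis by linarith
  qed
  then show "finite {m :: int. max (- (t - of_int m) * p) ((t - of_int m) * q) \<le> ?C}"
    by (intro finite_subset[OF _ finite_int_shift[of t "max (?C / p) (?C / q)"]]) blast
qed

section \<open>Bounded sublevel sets\<close>

text \<open>One quadrant, reflected onto the nonnegative one. The weights \<open>a\<close>,
  \<open>b\<close> belong to the quadrant's own piece, \<open>p\<close>, \<open>q\<close> to the
  piece across the first axis and \<open>q'\<close>, \<open>p'\<close> to the piece across the
  second. The last two assumptions express positivity along the two bounding half-axes.\<close>

lemma quadrant_bounded:
  fixes a b p q p' q' C :: real
  assumes "0 \<le> a" "0 \<le> b" "0 < a \<or> 0 < b" "0 \<le> p" "0 \<le> q" "0 \<le> p'" "0 \<le> q'"
    and "0 < a \<or> 0 < p" "0 < b \<or> 0 < p'"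
  shows "\<exists>K. \<forall>x y. 0 \<le> x \<longrightarrow> 0 \<le> y \<longrightarrow> x * a + y * b \<le> C \<longrightarrow> x * p - y * q \<le> C
    \<longrightarrow> - x * q' + y * p' \<le> C \<longrightarrow> x \<le> K \<and> y \<le> K"
proof -
  have x_le: "x \<le> C / a" if "0 < a" "0 \<le> y" "x * a + y * b \<le> C" for x y
    using that mult_nonneg_nonneg[OF that(2) assms(2)] by (simp add: pos_le_divide_eq)
  have y_le: "y \<le> C / b" if "0 < b" "0 \<le> x" "x * a + y * b \<le> C" for x y
    using that mult_nonneg_nonneg[OF that(2) assms(1)] by (simp add: pos_le_divide_eq)
  \<comment> \<open>The own piece bounds every coordinate in which its weight is positive. If it
    bounds only one, a neighbouring piece bounds the other, because its negative term is already
    controlled.\<close>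
  consider "0 < a" "0 < b" | "0 < a" "0 < p'" | "0 < b" "0 < p"
    using assms by blast
  then show ?thesis
  proof cases
    case 1
    then have "\<forall>x y. 0 \<le> x \<longrightarrow> 0 \<le> y \<longrightarrow> x * a + y * b \<le> C \<longrightarrow>
        x \<le> max (C / a) (C / b) \<and> y \<le> max (C / a) (C / b)"
      using x_le y_le by (meson le_max_iff_disj)
    then show ?thesis by blast
  next
    case 2
    let ?K = "max (C / a) ((C + C / a * q') / p')"
    have "x \<le> ?K \<and> y \<le> ?K"
      if h: "0 \<le> y" "x * a + y * b \<le> C" "- x * q' + y * p' \<le> C" for x y
    proof -
      have x: "x \<le> C / a" by (rule x_le) (use 2 h in auto)
      have "y * p' \<le> C + x * q'" using h by simp
      also have "\<dots> \<le> C + C / a * q'" using mult_right_mono[OF x assms(7)] by simp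
      finally have "y \<le> (C + C / a * q') / p'" using 2 by (simp add: pos_le_divide_eq)
      with x show ?thesis by linarith
    qed
    then show ?thesis by blast
  next
    case 3
    let ?K = "max (C / b) ((C + C / b * q) / p)"
    have "x \<le> ?K \<and> y \<le> ?K"
      if h: "0 \<le> x" "x * a + y * b \<le> C" "x * p - y * q \<le> C" for x y
    proof -
      have y: "y \<le> C / b" by (rule y_le) (use 3 h in auto)
      have "x * p \<le> C + y * q" using h by simp
      also have "\<dots> \<le> C + C / b * q" using mult_right_mono[OF y assms(5)] by simp
      finally have "x \<le> (C + C / b * q) / p" using 3 by (simp add: pos_le_divide_eq)
      with y show ?thesis by linarith
    qed
    then show ?thesis by blast
  qed
qed

text \<open>The four parts of \<open>axes\<close> say that the gauge is positive in the negative and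
  positive first, then the negative and positive second axis direction. Each quadrant is bounded
  separately, by its own piece and its two neighbours.\<close>

lemma four_max_coercive:
  assumes nn: "\<forall>i\<in>{1..4}. 0 \<le> v i \<and> 0 \<le> w i"
    and nz: "\<forall>i\<in>{1..4}. 0 < v i \<or> 0 < w i"
    and axes: "0 < v 1 \<or> 0 < v 4" "0 < v 2 \<or> 0 < v 3" "0 < w 1 \<or> 0 < w 2" "0 < w 3 \<or> 0 < w 4"
  shows "\<exists>K. \<forall>x y. four_max v w x y \<le> C \<longrightarrow> \<bar>x\<bar> \<le> K \<and> \<bar>y\<bar> \<le> K"
proof -
  have nn': "0 \<le> v 1" "0 \<le> v 2" "0 \<le> v 3" "0 \<le> v 4" "0 \<le> w 1" "0 \<le> w 2" "0 \<le> w 3" "0 \<le> w 4"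
    using nn by auto
  have nz': "0 < v 1 \<or> 0 < w 1" "0 < v 2 \<or> 0 < w 2" "0 < v 3 \<or> 0 < w 3" "0 < v 4 \<or> 0 < w 4"
    using nz by auto
  obtain K1 where K1: "\<forall>x y. 0 \<le> x \<longrightarrow> 0 \<le> y \<longrightarrow> x * v 1 + y * w 1 \<le> C \<longrightarrow> x * v 4 - y * w 4 \<le> C
    \<longrightarrow> - x * v 2 + y * w 2 \<le> C \<longrightarrow> x \<le> K1 \<and> y \<le> K1"
    using quadrant_bounded[of "v 1" "w 1" "v 4" "w 4" "w 2" "v 2" C] nn' nz' axes by blast
  obtain K2 where K2: "\<forall>x y. 0 \<le> x \<longrightarrow> 0 \<le> y \<longrightarrow> x * v 2 + y * w 2 \<le> C \<longrightarrow> x * v 3 - y * w 3 \<le> C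
    \<longrightarrow> - x * v 1 + y * w 1 \<le> C \<longrightarrow> x \<le> K2 \<and> y \<le> K2"
    using quadrant_bounded[of "v 2" "w 2" "v 3" "w 3" "w 1" "v 1" C] nn' nz' axes by blast
  obtain K3 where K3: "\<forall>x y. 0 \<le> x \<longrightarrow> 0 \<le> y \<longrightarrow> x * v 3 + y * w 3 \<le> C \<longrightarrow> x * v 2 - y * w 2 \<le> C
    \<longrightarrow> - x * v 4 + y * w 4 \<le> C \<longrightarrow> x \<le> K3 \<and> y \<le> K3"
    using quadrant_bounded[of "v 3" "w 3" "v 2" "w 2" "w 4" "v 4" C] nn' nz' axes by blast
  obtain K4 where K4: "\<forall>x y. 0 \<le> x \<longrightarrow> 0 \<le> y \<longrightarrow> x * v 4 + y * w 4 \<le> C \<longrightarrow> x * v 1 - y * w 1 \<le> C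
    \<longrightarrow> - x * v 3 + y * w 3 \<le> C \<longrightarrow> x \<le> K4 \<and> y \<le> K4"
    using quadrant_bounded[of "v 4" "w 4" "v 1" "w 1" "w 3" "v 3" C] nn' nz' axes by blast
  let ?K = "max (max K1 K2) (max K3 K4)"
  have "\<bar>x\<bar> \<le> ?K \<and> \<bar>y\<bar> \<le> ?K" if "four_max v w x y \<le> C" for x y
  proof -
    have h: "- x * v 1 - y * w 1 \<le> C" "x * v 2 - y * w 2 \<le> C"
      "x * v 3 + y * w 3 \<le> C" "- x * v 4 + y * w 4 \<le> C"
      using that by (simp_all add: four_max_eq)
    consider "x \<le> 0" "y \<le> 0" | "0 \<le> x" "y \<le> 0" | "0 \<le> x" "0 \<le> y" | "x \<le> 0" "0 \<le> y"
      by linarith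
    then show ?thesis
    proof cases
      case 1
      then show ?thesis using K1[rule_format, of "- x" "- y"] h by auto
    next
      case 2
      then show ?thesis using K2[rule_format, of x "- y"] h by auto
    next
      case 3
      then show ?thesis using K3[rule_format, of x y] h by auto
    next
      case 4
      then show ?thesis using K4[rule_format, of "- x" y] h by auto
    qed
  qed
  then show ?thesis by blast
qed

lemma ex_minimum_coercive:
  fixes G :: "real \<Rightarrow> real \<Rightarrow> real"
  assumes "\<And>C. \<exists>K. \<forall>x y. G x y \<le> C \<longrightarrow> \<bar>x\<bar> \<le> K \<and> \<bar>y\<bar> \<le> K"
  shows "\<exists>m n :: int. \<forall>m' n' :: int. G (s - of_int m) (t - of_int n) \<le> G (s - of_int m') (t - of_int n')"
proof -
  let ?F = "\<lambda>z :: int \<times> int. G (s - of_int (fst z)) (t - of_int (snd z))"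
  obtain K where K: "\<forall>x y. G x y \<le> ?F (0, 0) \<longrightarrow> \<bar>x\<bar> \<le> K \<and> \<bar>y\<bar> \<le> K"
    using assms by blast
  have "finite {z. ?F z \<le> ?F (0, 0)}"
  proof (rule finite_subset)
    show "{z. ?F z \<le> ?F (0, 0)} \<subseteq> {m. \<bar>s - of_int m\<bar> \<le> K} \<times> {n. \<bar>t - of_int n\<bar> \<le> K}"
      using K by (auto simp: mem_Times_iff)
  qed (simp add: finite_int_shift)
  from ex_minimum_if_finite_sublevel[OF this] show ?thesis by auto
qed

section \<open>Gauges vanishing in an axis direction\<close>

text \<open>First \<open>n\<close> is chosen optimal for the one-dimensional lower bound. Rounding
  \<open>s\<close> up or down then moves the first coordinate into the half-plane where
  \<open>G\<close> equals that bound.\<close>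

lemma ex_minimum_if_constant_on_rays:
  fixes G :: "real \<Rightarrow> real \<Rightarrow> real"
  assumes "0 < p" "0 < q"
    and lower: "\<And>x y. max (- y * p) (y * q) \<le> G x y"
    and ray: "(\<forall>x\<le>0. \<forall>y. G x y \<le> max (- y * p) (y * q)) \<or> (\<forall>x\<ge>0. \<forall>y. G x y \<le> max (- y * p) (y * q))"
  shows "\<exists>m n :: int. \<forall>m' n' :: int. G (s - of_int m) (t - of_int n) \<le> G (s - of_int m') (t - of_int n')"
proof -
  obtain n :: int where n: "\<forall>n' :: int. max (- (t - of_int n) * p) ((t - of_int n) * q)
      \<le> max (- (t - of_int n') * p) ((t - of_int n') * q)"
    using ex_minimum_two_max[OF assms(1,2)] by blast
  have "s - of_int \<lceil>s\<rceil> \<le> 0" "0 \<le> s - of_int \<lfloor>s\<rfloor>" by linarith+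
  then obtain m :: int
    where m: "G (s - of_int m) (t - of_int n) \<le> max (- (t - of_int n) * p) ((t - of_int n) * q)"
    using ray by metis
  have "G (s - of_int m) (t - of_int n) \<le> G (s - of_int m') (t - of_int n')" for m' n' :: int
    by (rule order_trans[OF m order_trans[OF n[rule_format] lower]])
  then show ?thesis by blast
qed

text \<open>The terms in \<open>x\<close> only decrease the left-hand sides. What remains is
  dominated by the term of the same sign and larger weight where it is positive, and by the
  nonnegative maximum elsewhere.\<close>

lemma two_pieces_le:
  fixes p q a b c d x y :: real
  assumes "0 \<le> b" "b \<le> p" "0 \<le> d" "d \<le> q" "0 \<le> a" "0 \<le> c" "x \<le> 0"
  shows "x * a - y * b \<le> max (- y * p) (y * q)" "x * c + y * d \<le> max (- y * p) (y * q)"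
proof -
  have xa: "x * a \<le> 0" "x * c \<le> 0" using assms by (simp_all add: mult_nonpos_nonneg)
  show "x * a - y * b \<le> max (- y * p) (y * q)"
  proof (cases "y \<le> 0")
    case True
    then have "y * p \<le> y * b" using assms by (intro mult_left_mono_neg)
    then show ?thesis using xa by (simp add: le_max_iff_disj)
  next
    case False
    then have "0 \<le> y * b" "0 \<le> y * q" using assms by auto
    then have "x * a - y * b \<le> y * q" using xa by linarith
    then show ?thesis by simp
  qed
  show "x * c + y * d \<le> max (- y * p) (y * q)"
  proof (cases "y \<le> 0")
    case True
    then have "y * d \<le> 0" "y * p \<le> 0" using assms by (auto intro: mult_nonpos_nonneg)
    then have "x * c + y * d \<le> - y * p" using xa by simp
    then show ?thesis by simp
  next
    case False
    then have "y * d \<le> y * q" using assms by (intro mult_left_mono) auto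
    then show ?thesis using xa by (simp add: le_max_iff_disj)
  qed
qed

text \<open>Normalisations of adjacent quadrants share a coefficient \<open>k\<close>. If one of
  them reduces to its \<open>k\<close> term, comparing the two orders the weights as
  \<open>two_pieces_le\<close> requires.\<close>

lemma weight_le_if_other_zero:
  fixes a b c e k :: real
  assumes "0 < k" "0 \<le> e" "0 \<le> a" "k * c = 1" "e * a + k * b = 1"
  shows "0 < c" "b \<le> c"
proof -
  show "0 < c" using assms(1,4) by (metis zero_less_mult_pos zero_less_one)
  have "0 \<le> e * a" using assms by simp
  then have "k * b \<le> k * c" using assms by linarith
  then show "b \<le> c" using assms(1) by simp
qed

lemma four_max_attains_min:
  fixes f1 f2 :: real
  assumes f: "0 < f1" "f1 < 1" "0 < f2" "f2 < 1"
    and nn: "\<forall>i\<in>{1..4}. 0 \<le> v i \<and> 0 \<le> w i"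
    and e: "f1 * v 1 + f2 * w 1 = 1" "(1 - f1) * v 2 + f2 * w 2 = 1"
      "(1 - f1) * v 3 + (1 - f2) * w 3 = 1" "f1 * v 4 + (1 - f2) * w 4 = 1"
  shows "\<exists>m n :: int. \<forall>m' n' :: int. four_max v w (s - of_int m) (t - of_int n)
    \<le> four_max v w (s - of_int m') (t - of_int n')"
proof -
  have nn': "0 \<le> v 1" "0 \<le> v 2" "0 \<le> v 3" "0 \<le> v 4" "0 \<le> w 1" "0 \<le> w 2" "0 \<le> w 3" "0 \<le> w 4"
    using nn by auto
  have g: "0 < 1 - f1" "0 < 1 - f2" "0 \<le> 1 - f1" "0 \<le> 1 - f2" "0 \<le> f1" "0 \<le> f2" using f by auto
  \<comment> \<open>In the first four cases the gauge vanishes in the negative first, positive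
    first, negative second and positive second axis direction, respectively.\<close>
  consider "v 1 = 0" "v 4 = 0" | "v 2 = 0" "v 3 = 0" | "w 1 = 0" "w 2 = 0" | "w 3 = 0" "w 4 = 0"
    | "0 < v 1 \<or> 0 < v 4" "0 < v 2 \<or> 0 < v 3" "0 < w 1 \<or> 0 < w 2" "0 < w 3 \<or> 0 < w 4"
    using nn' by linarith
  then show ?thesis
  proof cases
    case 1
    have le: "0 < w 1" "w 2 \<le> w 1" "0 < w 4" "w 3 \<le> w 4"
      using weight_le_if_other_zero[OF f(3) g(3) nn'(2) _ e(2), of "w 1"]
        weight_le_if_other_zero[OF g(2) g(3) nn'(3) _ e(3), of "w 4"] e(1,4) 1 by auto
    show ?thesis
    proof (rule ex_minimum_if_constant_on_rays[OF le(1,3)])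
      show "(\<forall>x\<le>0. \<forall>y. four_max v w x y \<le> max (- y * w 1) (y * w 4)) \<or>
        (\<forall>x\<ge>0. \<forall>y. four_max v w x y \<le> max (- y * w 1) (y * w 4))"
        using two_pieces_le[OF nn'(6) le(2) nn'(7) le(4) nn'(2,3)] 1
        by (intro disjI1) (auto simp: four_max_eq)
    qed (use 1 in \<open>auto simp: four_max_eq\<close>)
  next
    case 2
    have le: "0 < w 2" "w 1 \<le> w 2" "0 < w 3" "w 4 \<le> w 3"
      using weight_le_if_other_zero[OF f(3) g(5) nn'(1) _ e(1), of "w 2"]
        weight_le_if_other_zero[OF g(2) g(5) nn'(4) _ e(4), of "w 3"] e(2,3) 2 by auto
    show ?thesis
    proof (rule ex_minimum_if_constant_on_rays[OF le(1,3)])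
      \<comment> \<open>\<open>two_pieces_le\<close> concerns a left half-plane, so it is applied at
        the mirror image \<open>- x\<close>.\<close>
      have "four_max v w x y \<le> max (- y * w 2) (y * w 3)" if "0 \<le> x" for x y
        using two_pieces_le[OF nn'(5) le(2) nn'(8) le(4) nn'(1,4), of "- x" y] 2 that
        by (auto simp: four_max_eq)
      then show "(\<forall>x\<le>0. \<forall>y. four_max v w x y \<le> max (- y * w 2) (y * w 3)) \<or>
        (\<forall>x\<ge>0. \<forall>y. four_max v w x y \<le> max (- y * w 2) (y * w 3))" by blast
    qed (use 2 in \<open>auto simp: four_max_eq\<close>)
  next
    case 3
    have le: "0 < v 1" "v 4 \<le> v 1" "0 < v 2" "v 3 \<le> v 2"
      using weight_le_if_other_zero[OF f(1) g(4) nn'(8), of "v 1" "v 4"]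
        weight_le_if_other_zero[OF g(1) g(4) nn'(7), of "v 2" "v 3"] e 3 by (auto simp: add.commute)
    have "\<exists>n m :: int. \<forall>n' m' :: int. four_max v w (s - of_int m) (t - of_int n)
      \<le> four_max v w (s - of_int m') (t - of_int n')"
    \<comment> \<open>The zero direction must be in the first argument, so the coordinates are
      swapped.\<close>
    proof (rule ex_minimum_if_constant_on_rays[OF le(1,3), of "\<lambda>y x. four_max v w x y"])
      have "four_max v w x y \<le> max (- x * v 1) (x * v 2)" if "y \<le> 0" for x y
        using two_pieces_le[OF nn'(4) le(2) nn'(3) le(4) nn'(8,7), of y x] 3 that
        by (auto simp: four_max_eq algebra_simps)
      then show "(\<forall>y\<le>0. \<forall>x. four_max v w x y \<le> max (- x * v 1) (x * v 2)) \<or>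
        (\<forall>y\<ge>0. \<forall>x. four_max v w x y \<le> max (- x * v 1) (x * v 2))" by blast
    qed (use 3 in \<open>auto simp: four_max_eq\<close>)
    then show ?thesis by blast
  next
    case 4
    have le: "0 < v 4" "v 1 \<le> v 4" "0 < v 3" "v 2 \<le> v 3"
      using weight_le_if_other_zero[OF f(1) g(6) nn'(5), of "v 4" "v 1"]
        weight_le_if_other_zero[OF g(1) g(6) nn'(6), of "v 3" "v 2"] e 4 by (auto simp: add.commute)
    have "\<exists>n m :: int. \<forall>n' m' :: int. four_max v w (s - of_int m) (t - of_int n)
      \<le> four_max v w (s - of_int m') (t - of_int n')"
    proof (rule ex_minimum_if_constant_on_rays[OF le(1,3), of "\<lambda>y x. four_max v w x y"])
      have "four_max v w x y \<le> max (- x * v 4) (x * v 3)" if "0 \<le> y" for x y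
        using two_pieces_le[OF nn'(1) le(2) nn'(2) le(4) nn'(5,6), of "- y" x] 4 that
        by (auto simp: four_max_eq algebra_simps)
      then show "(\<forall>y\<le>0. \<forall>x. four_max v w x y \<le> max (- x * v 4) (x * v 3)) \<or>
        (\<forall>y\<ge>0. \<forall>x. four_max v w x y \<le> max (- x * v 4) (x * v 3))" by blast
    qed (use 4 in \<open>auto simp: four_max_eq\<close>)
    then show ?thesis by blast
  next
    case 5
    \<comment> \<open>Two zero weights in one piece would turn its normalisation into
      \<open>0 = 1\<close>.\<close>
    have "v 1 \<noteq> 0 \<or> w 1 \<noteq> 0" "v 2 \<noteq> 0 \<or> w 2 \<noteq> 0" "v 3 \<noteq> 0 \<or> w 3 \<noteq> 0" "v 4 \<noteq> 0 \<or> w 4 \<noteq> 0"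
      using e by auto
    moreover have "{1..4 :: nat} = {1, 2, 3, 4}" by auto
    ultimately have "\<forall>i\<in>{1..4}. 0 < v i \<or> 0 < w i" using nn' by auto
    from four_max_coercive[OF nn this 5] show ?thesis by (rule ex_minimum_coercive)
  qed
qed

section \<open>Upper bound and conclusion\<close>

text \<open>Each piece is largest at one corner of the box, where its value is the left-hand side of
  its normalisation.\<close>

lemma four_max_le_1_on_box:
  fixes f1 f2 :: real
  assumes nn: "\<forall>i\<in>{1..4}. 0 \<le> v i \<and> 0 \<le> w i"
    and e: "f1 * v 1 + f2 * w 1 = 1" "(1 - f1) * v 2 + f2 * w 2 = 1"
      "(1 - f1) * v 3 + (1 - f2) * w 3 = 1" "f1 * v 4 + (1 - f2) * w 4 = 1"
    and x: "- f1 \<le> x" "x \<le> 1 - f1" and y: "- f2 \<le> y" "y \<le> 1 - f2"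
  shows "four_max v w x y \<le> 1"
proof -
  have "- x * v 1 \<le> f1 * v 1" "x * v 2 \<le> (1 - f1) * v 2" "x * v 3 \<le> (1 - f1) * v 3" "- x * v 4 \<le> f1 * v 4"
    "- y * w 1 \<le> f2 * w 1" "- y * w 2 \<le> f2 * w 2" "y * w 3 \<le> (1 - f2) * w 3" "y * w 4 \<le> (1 - f2) * w 4"
    by (rule mult_right_mono; use x y nn in auto)+
  then show ?thesis using e unfolding four_max_eq by simp
qed

theorem theorem6p6:
  fixes f :: "real ^ 2"
    and J J1 :: "'j set"
    and r :: "'j \<Rightarrow> real ^ 2"
    and v w :: "nat \<Rightarrow> real"
  assumes "0 < f $ 1" "f $ 1 < 1" "0 < f $ 2" "f $ 2 < 1"
    and "finite J" "J1 \<subseteq> J"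
    and "\<forall>i\<in>{1..4}. 0 \<le> v i \<and> 0 \<le> w i"
    and "f $ 1 * v 1 + f $ 2 * w 1 = 1"
    and "(1 - f $ 1) * v 2 + f $ 2 * w 2 = 1"
    and "(1 - f $ 1) * v 3 + (1 - f $ 2) * w 3 = 1"
    and "f $ 1 * v 4 + (1 - f $ 2) * w 4 = 1"
  shows "\<forall>j\<in>J1. 0 \<le> strengthened_coeff v w (r j) \<and> strengthened_coeff v w (r j) \<le> 1"
proof
  fix j
  let ?g = "\<lambda>m n :: int. four_max v w (r j $ 1 - of_int m) (r j $ 2 - of_int n)"
  obtain m n :: int where min: "\<forall>m' n' :: int. ?g m n \<le> ?g m' n'"
    using four_max_attains_min[OF assms(1-4,7-11)] by blast
  have "strengthened_coeff v w (r j) = ?g m n"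
    unfolding strengthened_coeff_def using min by (intro Least_equality) auto
  moreover have "0 \<le> ?g m n" by (rule four_max_nonneg[OF assms(7)])
  \<comment> \<open>Subtracting the floor of \<open>t + c\<close> from \<open>t\<close> leaves the
    fractional part of \<open>t + c\<close> minus \<open>c\<close>, which lies between
    \<open>- c\<close> and \<open>1 - c\<close>. So this lattice translate is in the box.\<close>
  moreover have "?g \<lfloor>r j $ 1 + f $ 1\<rfloor> \<lfloor>r j $ 2 + f $ 2\<rfloor> \<le> 1"
    by (rule four_max_le_1_on_box[OF assms(7-11)]) linarith+
  ultimately show "0 \<le> strengthened_coeff v w (r j) \<and> strengthened_coeff v w (r j) \<le> 1"
    using min[rule_format, of "\<lfloor>r j $ 1 + f $ 1\<rfloor>" "\<lfloor>r j $ 2 + f $ 2\<rfloor>"] by linarith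
qed

end
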